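(* Let $n\ge2$ and let $M\in\mathbb{R}^{(n+1)\times(n+1)}$ be a type $D$ matrix determined by real numbers $a_1<a_2<\cdots<a_{n+1}$, with $a_{n+1}>0$ and $a_n<0$. Then $M^{-1}$ is a tridiagonal $F_0$-matrix.
   Context: Given real numbers $a_1<a_2<\cdots<a_m$, the matrix of type $D$ of order $m$ determined by them is $(a_{ij})_{1\le i,j\le m}$ with $a_{ij}=a_i$ if $i\le j$ and $a_{ij}=a_j$ otherwise (i.e. $a_{ij}=a_{\min(i,j)}$). The assertion about $M^{-1}$ includes that $M$ is nonsingular. Inequalities between matrices are entrywise. A real square matrix is a $Z$-matrix if all its off-diagonal entries are nonpositive; any $Z$-matrix can be written as $A=sI-B$ with $s\in\mathbb{R}$ and $B\ge 0$. Let $\rho$ denote the spectral radius, and for $B\in\mathbb{R}^{m\times m}$ let $\rho_{m-1}(B)$ be the maximum of the spectral radii of the principal submatrices of $B$ of order $m-1$. A $Z$-matrix $A=sI-B$ ($B\ge0$) of order $m$ is an $M$-matrix if $s\ge\rho(B)$, and an $N_0$-matrix if $\rho_{m-1}(B)\le s<\rho(B)$. A $Z$-matrix of order $m\ge 3$ is an $F_0$-matrix if all its principal submatrices of orders at most $m-2$ are $M$-matrices and at least one principal submatrix of order $m-1$ is an $N_0$-matrix. *)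

theory Defs
  imports
    "Jordan_Normal_Form.Spectral_Radius"
    "Jordan_Normal_Form.DL_Submatrix"
begin

text \<open>The numbers \<open>a 1 < \<dots> < a m\<close> are indexed from 1, whereas
  entries of matrices are indexed from 0; hence the index shifts below.\<close>

definition type_D_matrix :: "nat \<Rightarrow> (nat \<Rightarrow> real) \<Rightarrow> real mat \<Rightarrow> bool" where
  "type_D_matrix m a A \<longleftrightarrow>
     strict_mono_on {1..m} a \<and>
     A = mat m m (\<lambda>(i, j). if i \<le> j then a (i + 1) else a (j + 1))"

definition tridiagonal_mat :: "real mat \<Rightarrow> bool" where
  "tridiagonal_mat A \<longleftrightarrow> square_mat A \<and>
     (\<forall>i < dim_row A. \<forall>j < dim_col A. i + 1 < j \<or> j + 1 < i \<longrightarrow> A $$ (i, j) = 0)"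

definition Z_matrix :: "real mat \<Rightarrow> bool" where
  "Z_matrix A \<longleftrightarrow> square_mat A \<and>
     (\<forall>i < dim_row A. \<forall>j < dim_col A. i \<noteq> j \<longrightarrow> A $$ (i, j) \<le> 0)"

definition real_spectral_radius :: "real mat \<Rightarrow> real" where
  "real_spectral_radius B = spectral_radius (map_mat complex_of_real B)"

definition principal_submatrices :: "nat \<Rightarrow> 'a mat \<Rightarrow> 'a mat set" where
  "principal_submatrices k A =
     {submatrix A I I | I. I \<subseteq> {..<dim_row A} \<and> card I = k}"

definition rho_sub :: "nat \<Rightarrow> real mat \<Rightarrow> real" where
  "rho_sub k B = Max (real_spectral_radius ` principal_submatrices k B)"

definition Z_splitting :: "real mat \<Rightarrow> real \<Rightarrow> real mat \<Rightarrow> bool" where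
  "Z_splitting A s B \<longleftrightarrow>
     0\<^sub>m (dim_row A) (dim_row A) \<le> B \<and> A = s \<cdot>\<^sub>m 1\<^sub>m (dim_row A) - B"

text \<open>A Z-matrix has many splittings \<open>A = s I - B\<close> with \<open>B \<ge> 0\<close>. The conditions
  below do not depend on the choice: by Perron--Frobenius, replacing \<open>s\<close> and \<open>B\<close> by
  \<open>s + t\<close> and \<open>B + t I\<close> (with \<open>B\<close> and \<open>B + t I\<close> nonnegative) shifts all the spectral radii by \<open>t\<close>.
  The spectral radius is the maximum of an empty set for the matrix of order 0, so only
  orders at least 1 are considered; \<open>\<rho>\<^bsub>m-1\<^esub>\<close> thus requires \<open>m \<ge> 2\<close>.\<close>

definition M_matrix :: "real mat \<Rightarrow> bool" where
  "M_matrix A \<longleftrightarrow> Z_matrix A \<and> 1 \<le> dim_row A \<and>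
     (\<exists>s B. Z_splitting A s B \<and> real_spectral_radius B \<le> s)"

definition N0_matrix :: "real mat \<Rightarrow> bool" where
  "N0_matrix A \<longleftrightarrow> Z_matrix A \<and> 2 \<le> dim_row A \<and>
     (\<exists>s B. Z_splitting A s B \<and>
        rho_sub (dim_row A - 1) B \<le> s \<and> s < real_spectral_radius B)"

definition F0_matrix :: "real mat \<Rightarrow> bool" where
  "F0_matrix A \<longleftrightarrow> Z_matrix A \<and> 3 \<le> dim_row A \<and>
     (\<forall>k \<in> {1..dim_row A - 2}. \<forall>C \<in> principal_submatrices k A. M_matrix C) \<and>
     (\<exists>C \<in> principal_submatrices (dim_row A - 1) A. N0_matrix C)"

end

theory Submission
  imports Defs
begin

text \<open>Put \<open>m = n + 1\<close> and \<open>N = M\<^sup>-\<^sup>1\<close>. The form of \<open>N\<close> is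
  \<open>y\<^sub>1\<^sup>2 / a\<^sub>1 + \<Sum>j\<ge>2. (y\<^sub>j - y\<^sub>j\<^sub>-\<^sub>1)\<^sup>2 / (a\<^sub>j - a\<^sub>j\<^sub>-\<^sub>1)\<close>, so \<open>N\<close> is a tridiagonal Z-matrix.
  For \<open>p \<le> n\<close> the negative of the \<open>p\<close>-th column of \<open>M\<close> is a positive vector \<open>u\<close> with
  \<open>N u = -e\<^sub>p\<close>. Hence \<open>N\<^sub>I u\<^sub>I \<ge> 0\<close> for every \<open>I\<close> with \<open>p \<notin> I\<close>, and a positive vector
  with \<open>B u \<le> s u\<close>, where \<open>N\<^sub>I = s I - B\<close>, forces \<open>\<rho>(B) \<le> s\<close>; this covers all index sets except \<open>{1..n}\<close>
  and the full one.
  For \<open>I = {1..n}\<close> the vector \<open>x = \<Sum>j\<le>n. (a\<^sub>j / a\<^sub>m) M\<^sub>m - M\<^sub>j\<close>, a combination of columns of \<open>M\<close>,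
  vanishes in the last entry, is positive elsewhere, and satisfies \<open>N\<^sub>I x\<^sub>I = -1\<close> entrywise; this
  yields \<open>B x > s x\<close> and hence \<open>\<rho>(B) > s\<close>.\<close>

section \<open>Collatz-Wielandt bounds on the spectral radius of a nonnegative matrix\<close>

text \<open>Take an eigenvector \<open>v\<close> for an eigenvalue \<open>l\<close> of largest
  modulus and a row \<open>i\<close> where |v_j| / u_j is maximal, with value \<open>g i\<close>. In
  that row the triangle inequality gives |l| |v_i| <= g_i (B u)_i <= s g_i u_i = s |v_i|.\<close>

lemma real_spectral_radius_le:
  fixes u :: "nat \<Rightarrow> real"
  assumes B: "B \<in> carrier_mat k k" and k: "k > 0"
    and nonneg: "\<And>i j. i < k \<Longrightarrow> j < k \<Longrightarrow> B $$ (i, j) \<ge> 0"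
    and u: "\<And>i. i < k \<Longrightarrow> u i > 0"
    and le: "\<And>i. i < k \<Longrightarrow> (\<Sum>j<k. B $$ (i, j) * u j) \<le> s * u i"
  shows "real_spectral_radius B \<le> s"
proof -
  let ?A = "map_mat complex_of_real B"
  have A: "?A \<in> carrier_mat k k" using B by simp
  obtain l where l: "eigenvalue ?A l" "real_spectral_radius B = norm l"
    using spectral_radius_mem_max(1)[OF A k]
    unfolding real_spectral_radius_def spectrum_def by auto
  obtain v where v: "v \<in> carrier_vec k" "v \<noteq> 0\<^sub>v k" "?A *\<^sub>v v = l \<cdot>\<^sub>v v"
    using l(1) A unfolding eigenvalue_def eigenvector_def by auto
  define g where "g j = norm (v $ j) / u j" for j
  obtain i where i: "i < k" "\<And>j. j < k \<Longrightarrow> g j \<le> g i"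
  proof -
    have "finite (g ` {..<k})" "g ` {..<k} \<noteq> {}" using k by auto
    from Max_in[OF this] obtain i where "i < k" "Max (g ` {..<k}) = g i" by auto
    moreover have "g j \<le> Max (g ` {..<k})" if "j < k" for j using that by (intro Max_ge) auto
    ultimately show ?thesis using that by auto
  qed
  have bound: "norm (v $ j) \<le> g i * u j" if "j < k" for j
    using i(2)[OF that] u[OF that] by (simp add: g_def field_simps)
  have pos: "g i > 0"
  proof (rule ccontr)
    assume "\<not> g i > 0"
    then have "norm (v $ j) \<le> 0" if "j < k" for j
      using bound[OF that] u[OF that] by (meson linorder_not_less mult_nonpos_nonneg order.strict_implies_order order_trans)
    then have "v = 0\<^sub>v k" using v(1) by (intro eq_vecI) auto
    with v(2) show False by simp
  qed
  have "l * v $ i = (?A *\<^sub>v v) $ i" using v i by simp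
  also have "\<dots> = (\<Sum>j<k. complex_of_real (B $$ (i, j)) * v $ j)"
    using i v(1) B by (auto simp: scalar_prod_def lessThan_atLeast0 intro!: sum.cong)
  finally have "norm l * norm (v $ i) = norm (\<Sum>j<k. complex_of_real (B $$ (i, j)) * v $ j)"
    by (simp flip: norm_mult)
  also have "\<dots> \<le> (\<Sum>j<k. norm (complex_of_real (B $$ (i, j)) * v $ j))" by (rule norm_sum)
  also have "\<dots> \<le> (\<Sum>j<k. B $$ (i, j) * (g i * u j))"
    using nonneg i bound by (intro sum_mono) (auto simp: norm_mult intro!: mult_left_mono)
  also have "\<dots> = g i * (\<Sum>j<k. B $$ (i, j) * u j)" by (simp add: sum_distrib_left algebra_simps)
  also have "\<dots> \<le> g i * (s * u i)" using le i pos by (intro mult_left_mono) auto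
  finally have "norm l * (g i * u i) \<le> s * (g i * u i)"
    using u[OF i(1)] by (simp add: g_def field_simps)
  then show ?thesis using l(2) pos u[OF i(1)] by simp
qed

text \<open>Iterates A x >= q x. Nonnegativity of the powers is carried through the induction, since
  it lets \<open>A ^\<^sub>m e\<close> act on both sides of the inequality.\<close>

lemma pow_mat_subinvariant:
  fixes x :: "nat \<Rightarrow> real"
  assumes A: "A \<in> carrier_mat k k"
    and nonneg: "\<And>i j. i < k \<Longrightarrow> j < k \<Longrightarrow> A $$ (i, j) \<ge> 0"
    and q: "q \<ge> 0"
    and ge: "\<And>i. i < k \<Longrightarrow> q * x i \<le> (\<Sum>j<k. A $$ (i, j) * x j)"
    and i: "i < k"
  shows "q ^ e * x i \<le> (\<Sum>j<k. (A ^\<^sub>m e) $$ (i, j) * x j)"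
proof -
  have C: "A ^\<^sub>m e \<in> carrier_mat k k" for e using A by simp
  have entry: "(A ^\<^sub>m Suc e) $$ (i, j) = (\<Sum>l<k. (A ^\<^sub>m e) $$ (i, l) * A $$ (l, j))"
    if "i < k" "j < k" for i j e
    using that A C[of e] by (auto simp: scalar_prod_def lessThan_atLeast0 intro!: sum.cong)
  have "(\<forall>j<k. (A ^\<^sub>m e) $$ (i, j) \<ge> 0) \<and> q ^ e * x i \<le> (\<Sum>j<k. (A ^\<^sub>m e) $$ (i, j) * x j)"
  proof (induction e)
    case 0
    have "(\<Sum>j<k. (A ^\<^sub>m 0) $$ (i, j) * x j) = (\<Sum>j<k. if j = i then x j else 0)"
      using A i by (intro sum.cong) auto
    then show ?case using A i by simp
  next
    case (Suc e)
    have "q ^ Suc e * x i \<le> q * (\<Sum>l<k. (A ^\<^sub>m e) $$ (i, l) * x l)"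
      using Suc q by (simp add: mult.assoc mult_left_mono)
    also have "\<dots> = (\<Sum>l<k. (A ^\<^sub>m e) $$ (i, l) * (q * x l))"
      by (simp add: sum_distrib_left algebra_simps)
    also have "\<dots> \<le> (\<Sum>l<k. (A ^\<^sub>m e) $$ (i, l) * (\<Sum>j<k. A $$ (l, j) * x j))"
      using Suc ge by (intro sum_mono mult_left_mono) auto
    also have "\<dots> = (\<Sum>j<k. (\<Sum>l<k. (A ^\<^sub>m e) $$ (i, l) * A $$ (l, j)) * x j)"
      by (simp add: sum_distrib_left sum_distrib_right algebra_simps) (rule sum.swap)
    also have "\<dots> = (\<Sum>j<k. (A ^\<^sub>m Suc e) $$ (i, j) * x j)"
      using i by (intro sum.cong) (simp_all add: entry del: pow_mat.simps)
    finally show ?case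
      using i Suc nonneg by (auto simp: entry simp del: pow_mat.simps intro!: sum_nonneg)
  qed
  then show ?thesis by simp
qed

text \<open>If \<open>\<rho>(B) \<le> s\<close>, then for \<open>q > s\<close> the powers of \<open>B / q\<close> stay bounded, whereas \<open>B x > s x\<close>
  makes them grow geometrically along \<open>x\<close> when \<open>q\<close> is close to \<open>s\<close>.\<close>
lemma less_real_spectral_radius:
  fixes x :: "nat \<Rightarrow> real"
  assumes B: "B \<in> carrier_mat k k" and k: "k > 0" and s: "s > 0"
    and nonneg: "\<And>i j. i < k \<Longrightarrow> j < k \<Longrightarrow> B $$ (i, j) \<ge> 0"
    and x: "\<And>i. i < k \<Longrightarrow> x i > 0"
    and less: "\<And>i. i < k \<Longrightarrow> s * x i < (\<Sum>j<k. B $$ (i, j) * x j)"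
  shows "s < real_spectral_radius B"
proof (rule ccontr)
  assume "\<not> s < real_spectral_radius B"
  then have le: "real_spectral_radius B \<le> s" by simp
  define g where "g i = (\<Sum>j<k. B $$ (i, j) * x j) / x i" for i
  \<comment> \<open>The largest constant with B x >= r x. As a minimum of finitely many ratios above
    \<open>s\<close>, it exceeds \<open>s\<close>.\<close>
  define r where "r = Min (g ` {..<k})"
  have fin: "finite (g ` {..<k})" "g ` {..<k} \<noteq> {}" using k by auto
  have sr: "s < r" unfolding r_def
    using fin less x by (subst Min_gr_iff) (auto simp: g_def field_simps)
  have r: "r * x i \<le> (\<Sum>j<k. B $$ (i, j) * x j)" if "i < k" for i
  proof -
    have "r \<le> g i" unfolding r_def using that fin by (intro Min_le) auto
    then show ?thesis using x[OF that] by (simp add: g_def field_simps)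
  qed
  \<comment> \<open>Both gaps matter: s < q makes the spectral radius of B / q less than 1, and q <
    r makes the powers of r / q unbounded.\<close>
  obtain q where q: "s < q" "q < r" using dense[OF sr] by auto
  have q0: "q > 0" using s q by simp
  define A where "A = (1 / q) \<cdot>\<^sub>m B"
  have A: "A \<in> carrier_mat k k" using B by (simp add: A_def)
  let ?A = "map_mat complex_of_real A" and ?B = "map_mat complex_of_real B"
  have cA: "?A \<in> carrier_mat k k" and cB: "?B \<in> carrier_mat k k" using A B by auto
  have "spectral_radius ?A < 1"
  proof -
    \<comment> \<open>An eigenvalue \<open>l\<close> of B / q gives the eigenvalue q l of B, hence q
      |l| <= s < q.\<close>
    obtain l where l: "eigenvalue ?A l" "spectral_radius ?A = norm l"
      using spectral_radius_mem_max(1)[OF cA k] unfolding spectrum_def by auto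
    obtain v where v: "v \<in> carrier_vec k" "v \<noteq> 0\<^sub>v k" "?A *\<^sub>v v = l \<cdot>\<^sub>v v"
      using l(1) cA unfolding eigenvalue_def eigenvector_def by auto
    have "?B = complex_of_real q \<cdot>\<^sub>m ?A"
      using B q0 by (intro eq_matI) (auto simp: A_def)
    then have "?B *\<^sub>v v = complex_of_real q \<cdot>\<^sub>v (?A *\<^sub>v v)"
      using v(1) cA by auto
    then have "eigenvalue ?B (complex_of_real q * l)"
      using v cB unfolding eigenvalue_def eigenvector_def
      by (intro exI[of _ v]) (auto simp: smult_smult_assoc)
    then have "norm (complex_of_real q * l) \<le> real_spectral_radius B"
      using spectral_radius_mem_max(2)[OF cB k, of "norm (complex_of_real q * l)"]
      unfolding spectrum_def real_spectral_radius_def by auto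
    then have "q * norm l \<le> real_spectral_radius B" using q0 by (simp add: norm_mult)
    then have "q * norm l < q * 1" using le q by linarith
    then show ?thesis using l(2) q0 by (simp only: mult_less_cancel_left_pos)
  qed
  from spectral_radius_jnf_norm_bound_less_1_upper_triangular[OF cA this]
  obtain c where c: "\<And>e. norm_bound (?A ^\<^sub>m e) c" by auto
  have bnd: "(A ^\<^sub>m e) $$ (0, j) \<le> c" if "j < k" for e j
  proof -
    have P: "A ^\<^sub>m e \<in> carrier_mat k k" using A by simp
    have "?A ^\<^sub>m e = map_mat complex_of_real (A ^\<^sub>m e)"
      by (rule of_real_hom.mat_hom_pow[OF A, symmetric])
    with c[of e] have "norm (map_mat complex_of_real (A ^\<^sub>m e) $$ (0, j)) \<le> c"
      unfolding norm_bound_def using that k P by (metis carrier_matD index_map_mat(2,3))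
    moreover have "map_mat complex_of_real (A ^\<^sub>m e) $$ (0, j) = complex_of_real ((A ^\<^sub>m e) $$ (0, j))"
      using that k P by (metis carrier_matD index_map_mat(1))
    ultimately show ?thesis by simp
  qed
  have "(r / q) ^ e * x 0 \<le> c * (\<Sum>j<k. x j)" for e
  proof -
    have "(r / q) ^ e * x 0 \<le> (\<Sum>j<k. (A ^\<^sub>m e) $$ (0, j) * x j)"
    proof (rule pow_mat_subinvariant[OF A])
      show "r / q * x i \<le> (\<Sum>j<k. A $$ (i, j) * x j)" if "i < k" for i
        using r[OF that] that B q0
        by (simp add: A_def field_simps flip: sum_divide_distrib)
    qed (use k B nonneg q q0 sr s in \<open>auto simp: A_def\<close>)
    also have "\<dots> \<le> (\<Sum>j<k. c * x j)"
      using bnd x by (intro sum_mono mult_right_mono) (auto intro: less_imp_le)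
    finally show ?thesis by (simp add: sum_distrib_left)
  qed
  moreover obtain e where "c * (\<Sum>j<k. x j) / x 0 < (r / q) ^ e"
    using real_arch_pow[of "r / q"] q q0 by auto
  ultimately show False
    using x[OF k] by (simp add: field_simps) (meson linorder_not_less)
qed

section \<open>Principal submatrices, indexed through \<open>pick\<close>\<close>

lemma pick_lessThan:
  assumes "i < n"
  shows "pick {..<n} i = i"
proof -
  have "{a \<in> {..<n}. a < i} = {..<i}" using assms by auto
  then show ?thesis using pick_card_in_set[of i "{..<n}"] assms by simp
qed

lemma bij_betw_pick:
  assumes "finite I"
  shows "bij_betw (pick I) {..<card I} I"
proof -
  have "inj_on (pick I) {..<card I}"
    by (intro linorder_inj_onI) (use pick_mono_le in \<open>fastforce+\<close>)
  moreover from this have "pick I ` {..<card I} = I"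
    using assms by (intro card_subset_eq) (auto simp: card_image pick_in_set_le)
  ultimately show ?thesis by (simp add: bij_betw_def)
qed

lemma principal_submatrix:
  assumes "A \<in> carrier_mat k k" "I \<subseteq> {..<k}"
  shows "submatrix A I I = mat (card I) (card I) (\<lambda>(i, j). A $$ (pick I i, pick I j))"
proof -
  have "{i. i < k \<and> i \<in> I} = I" using assms by auto
  then show ?thesis using assms by (simp add: submatrix_def)
qed

text \<open>Dropping the columns outside \<open>I\<close> only lowers the row sums, so a single
  positive vector on the full index set serves for every admissible \<open>I\<close>.\<close>

lemma real_spectral_radius_submatrix_le:
  fixes u :: "nat \<Rightarrow> real"
  assumes B: "B \<in> carrier_mat k k" and I: "I \<subseteq> {..<k}" "I \<noteq> {}"
    and nonneg: "\<And>i j. i < k \<Longrightarrow> j < k \<Longrightarrow> B $$ (i, j) \<ge> 0"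
    and u: "\<And>i. i < k \<Longrightarrow> u i > 0"
    and le: "\<And>i. i \<in> I \<Longrightarrow> (\<Sum>j<k. B $$ (i, j) * u j) \<le> s * u i"
  shows "real_spectral_radius (submatrix B I I) \<le> s"
proof (rule real_spectral_radius_le)
  have fin: "finite I" using I finite_subset by blast
  have P: "pick I i \<in> I" "pick I i < k" if "i < card I" for i
    using pick_in_set_le[OF that] I by auto
  show "submatrix B I I \<in> carrier_mat (card I) (card I)"
    using B I by (simp add: principal_submatrix)
  show "card I > 0" using fin I by (simp add: card_gt_0_iff)
  show "u (pick I i) > 0" if "i < card I" for i using P[OF that] u by simp
  show "submatrix B I I $$ (i, j) \<ge> 0" if "i < card I" "j < card I" for i j
    using that P nonneg B I by (simp add: principal_submatrix)
  fix i assume i: "i < card I"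
  have "(\<Sum>j<card I. submatrix B I I $$ (i, j) * u (pick I j))
      = (\<Sum>j<card I. B $$ (pick I i, pick I j) * u (pick I j))"
    using i B I by (intro sum.cong) (auto simp: principal_submatrix)
  also have "\<dots> = (\<Sum>j\<in>I. B $$ (pick I i, j) * u j)"
    by (rule sum.reindex_bij_betw[OF bij_betw_pick[OF fin], of "\<lambda>j. B $$ (pick I i, j) * u j"])
  also have "\<dots> \<le> (\<Sum>j<k. B $$ (pick I i, j) * u j)"
    using I P[OF i] nonneg u by (intro sum_mono2) (auto intro!: mult_nonneg_nonneg intro: less_imp_le)
  also have "\<dots> \<le> s * u (pick I i)" using le P[OF i] by simp
  finally show "(\<Sum>j<card I. submatrix B I I $$ (i, j) * u (pick I j)) \<le> s * u (pick I i)" .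
qed

section \<open>Criteria for M- and N0-matrices by positive vectors\<close>

lemma Z_matrix_submatrix:
  assumes A: "A \<in> carrier_mat k k" and Z: "Z_matrix A" and I: "I \<subseteq> {..<k}"
  shows "Z_matrix (submatrix A I I)"
proof -
  have "finite I" using I finite_subset by blast
  then have "inj_on (pick I) {..<card I}" using bij_betw_pick by (auto simp: bij_betw_def)
  moreover have "pick I i < k" if "i < card I" for i
    using pick_in_set_le[OF that] I by auto
  ultimately have "A $$ (pick I i, pick I j) \<le> 0" if "i < card I" "j < card I" "i \<noteq> j" for i j
    using that A Z unfolding Z_matrix_def inj_on_def by (metis carrier_matD lessThan_iff)
  then show ?thesis by (simp add: Z_matrix_def principal_submatrix[OF A I])
qed

lemma Z_splittingE:
  assumes A: "A \<in> carrier_mat k k" and Z: "Z_matrix A"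
  obtains s B where "s > 0" "B \<in> carrier_mat k k" "A = s \<cdot>\<^sub>m 1\<^sub>m k - B"
    "\<And>i j. i < k \<Longrightarrow> j < k \<Longrightarrow> B $$ (i, j) \<ge> 0"
proof
  \<comment> \<open>The sum dominates each diagonal entry, so \<open>?B\<close> is nonnegative on
    the diagonal; the 1 gives the positivity that \<open>less_real_spectral_radius\<close>
    requires.\<close>
  let ?s = "1 + (\<Sum>i<k. \<bar>A $$ (i, i)\<bar>)"
  let ?B = "?s \<cdot>\<^sub>m 1\<^sub>m k - A"
  show "?s > 0" by (smt (verit) sum_nonneg abs_ge_zero)
  show "?B \<in> carrier_mat k k" using A by (rule minus_carrier_mat)
  show "A = ?s \<cdot>\<^sub>m 1\<^sub>m k - ?B" using A by (intro eq_matI) auto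
  fix i j assume ij: "i < k" "j < k"
  have "\<bar>A $$ (i, i)\<bar> \<le> (\<Sum>i<k. \<bar>A $$ (i, i)\<bar>)"
    using ij by (intro member_le_sum) auto
  then show "?B $$ (i, j) \<ge> 0" using ij A Z by (auto simp: Z_matrix_def)
qed

lemma sum_splitting:
  fixes u :: "nat \<Rightarrow> real"
  assumes "B \<in> carrier_mat k k" "A = s \<cdot>\<^sub>m 1\<^sub>m k - B" "i < k"
  shows "(\<Sum>j<k. B $$ (i, j) * u j) = s * u i - (\<Sum>j<k. A $$ (i, j) * u j)"
proof -
  have "(\<Sum>j<k. A $$ (i, j) * u j) = (\<Sum>j<k. (if j = i then s * u j else 0) - B $$ (i, j) * u j)"
    using assms by (intro sum.cong) (auto simp: algebra_simps)
  then show ?thesis using assms by (simp add: sum_subtractf)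
qed

text \<open>A splitting s I - B of \<open>A\<close> restricts to the submatrix with the same
  \<open>s\<close>, since \<open>pick I\<close> is injective on the positions. The sign condition on
  the rows in \<open>I\<close> says B u <= s u there.\<close>

lemma M_matrix_submatrix:
  fixes u :: "nat \<Rightarrow> real"
  assumes A: "A \<in> carrier_mat k k" and Z: "Z_matrix A"
    and I: "I \<subseteq> {..<k}" "I \<noteq> {}"
    and u: "\<And>i. i < k \<Longrightarrow> u i > 0"
    and ge: "\<And>i. i \<in> I \<Longrightarrow> (\<Sum>j<k. A $$ (i, j) * u j) \<ge> 0"
  shows "M_matrix (submatrix A I I)"
proof -
  have fin: "finite I" using I finite_subset by blast
  obtain s B where sB: "B \<in> carrier_mat k k" "A = s \<cdot>\<^sub>m 1\<^sub>m k - B"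
    "\<And>i j. i < k \<Longrightarrow> j < k \<Longrightarrow> B $$ (i, j) \<ge> 0"
    using Z_splittingE[OF A Z] by metis
  have P: "pick I i < k" if "i < card I" for i
    using pick_in_set_le[OF that] I by auto
  have inj: "pick I i = pick I j \<longleftrightarrow> i = j" if "i < card I" "j < card I" for i j
    using bij_betw_pick[OF fin] that by (auto simp: bij_betw_def inj_on_def)
  have "real_spectral_radius (submatrix B I I) \<le> s"
  proof (rule real_spectral_radius_submatrix_le[OF sB(1) I sB(3) u])
    fix i assume "i \<in> I"
    then show "(\<Sum>j<k. B $$ (i, j) * u j) \<le> s * u i"
      using ge[of i] sum_splitting[OF sB(1,2)] I by auto
  qed
  moreover have "Z_splitting (submatrix A I I) s (submatrix B I I)"
    unfolding Z_splitting_def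
    using A I sB P inj
    by (auto simp: principal_submatrix less_eq_mat_def intro!: eq_matI)
  ultimately show ?thesis
    unfolding M_matrix_def using Z_matrix_submatrix[OF A Z I(1)] fin I
    by (auto simp: principal_submatrix[OF A I(1)] card_gt_0_iff Suc_le_eq)
qed

text \<open>An index set of size k - 1 misses some \<open>p\<close>, and \<open>u p\<close> then
  bounds the spectral radius of that submatrix of \<open>B\<close> by \<open>s\<close>. The vector
  \<open>x\<close> satisfies B x > s x, which pushes the radius of \<open>B\<close> itself above
  \<open>s\<close>.\<close>

lemma N0_matrixI:
  fixes x :: "nat \<Rightarrow> real" and u :: "nat \<Rightarrow> nat \<Rightarrow> real"
  assumes A: "A \<in> carrier_mat k k" and Z: "Z_matrix A" and k: "k \<ge> 2"
    and u: "\<And>p i. p < k \<Longrightarrow> i < k \<Longrightarrow> u p i > 0"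
    and ge: "\<And>p i. p < k \<Longrightarrow> i < k \<Longrightarrow> i \<noteq> p \<Longrightarrow> (\<Sum>j<k. A $$ (i, j) * u p j) \<ge> 0"
    and x: "\<And>i. i < k \<Longrightarrow> x i > 0"
    and less: "\<And>i. i < k \<Longrightarrow> (\<Sum>j<k. A $$ (i, j) * x j) < 0"
  shows "N0_matrix A"
proof -
  obtain s B where sB: "s > 0" "B \<in> carrier_mat k k" "A = s \<cdot>\<^sub>m 1\<^sub>m k - B"
    "\<And>i j. i < k \<Longrightarrow> j < k \<Longrightarrow> B $$ (i, j) \<ge> 0"
    using Z_splittingE[OF A Z] by metis
  have "s < real_spectral_radius B"
    using k less sum_splitting[OF sB(2,3)] by (intro less_real_spectral_radius[OF sB(2) _ sB(1,4) x]) auto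
  moreover have "rho_sub (k - 1) B \<le> s"
  proof -
    let ?S = "{I. I \<subseteq> {..<k} \<and> card I = k - 1}"
    have S: "principal_submatrices (k - 1) B = (\<lambda>I. submatrix B I I) ` ?S"
      using sB(2) by (auto simp: principal_submatrices_def)
    have "finite ?S" by (rule finite_subset[of _ "Pow {..<k}"]) auto
    moreover have "{..<k - 1} \<in> ?S" by auto
    then have "?S \<noteq> {}" by blast
    moreover have "real_spectral_radius (submatrix B I I) \<le> s" if "I \<in> ?S" for I
    proof -
      have I: "I \<subseteq> {..<k}" "I \<noteq> {}" using that k by auto
      have "I \<noteq> {..<k}" using that k by auto
      then obtain p where p: "p < k" "p \<notin> I" using I by auto
      show ?thesis
      proof (rule real_spectral_radius_submatrix_le[OF sB(2) I sB(4) u[OF p(1)]])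
        fix i assume "i \<in> I"
        then show "(\<Sum>j<k. B $$ (i, j) * u p j) \<le> s * u p i"
          using ge[of p i] sum_splitting[OF sB(2,3), of i "u p"] I p by force
      qed
    qed
    ultimately show ?thesis
      unfolding rho_sub_def S by (subst Max_le_iff) auto
  qed
  ultimately show ?thesis
    unfolding N0_matrix_def Z_splitting_def using A Z k sB
    by (auto simp: less_eq_mat_def intro!: exI[of _ s] exI[of _ B])
qed

section \<open>The tridiagonal inverse of a type D matrix\<close>

text \<open>The matrix of the quadratic form \<open>\<Sum>j. w j * (y j - y (j - 1))\<^sup>2\<close>, where \<open>y (-1) = 0\<close>.\<close>
definition path_form_mat :: "nat \<Rightarrow> (nat \<Rightarrow> 'a :: comm_ring_1) \<Rightarrow> 'a mat" where
  "path_form_mat m w = mat m m (\<lambda>(j, k).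
     w j * (of_bool (k = j) - of_bool (k + 1 = j))
     - (if j + 1 < m then w (j + 1) * (of_bool (k = j + 1) - of_bool (k = j)) else 0))"

text \<open>Row \<open>j\<close> is half the derivative of the form in y_j: the weighted increment
  of \<open>g\<close> at \<open>j\<close> minus the one at j + 1, which is absent in the last
  row.\<close>

lemma path_form_mat_apply:
  fixes w g :: "nat \<Rightarrow> 'a :: comm_ring_1"
  assumes "j < m"
  shows "(\<Sum>k<m. path_form_mat m w $$ (j, k) * g k) =
    w j * (g j - (if j = 0 then 0 else g (j - 1)))
     - (if j + 1 < m then w (j + 1) * (g (j + 1) - g j) else 0)"
proof -
  have "(\<Sum>k<m. path_form_mat m w $$ (j, k) * g k) =
     w j * ((\<Sum>k<m. of_bool (k = j) * g k) - (\<Sum>k<m. of_bool (k + 1 = j) * g k))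
     - (if j + 1 < m then w (j + 1) * ((\<Sum>k<m. of_bool (k = j + 1) * g k) - (\<Sum>k<m. of_bool (k = j) * g k)) else 0)"
  proof -
    have "(\<Sum>k<m. path_form_mat m w $$ (j, k) * g k) = (\<Sum>k<m.
       w j * (of_bool (k = j) * g k - of_bool (k + 1 = j) * g k)
       - (if j + 1 < m then w (j + 1) * (of_bool (k = j + 1) * g k - of_bool (k = j) * g k) else 0))"
      using assms by (intro sum.cong) (simp_all add: path_form_mat_def left_diff_distrib mult.assoc)
    then show ?thesis
      by (cases "j + 1 < m")
        (simp_all only: sum_subtractf if_True if_False sum.neutral_const flip: sum_distrib_left)
  qed
  moreover have delta: "(\<Sum>k<m. of_bool (k = l) * g k) = g l" if "l < m" for l
  proof -
    have "(\<Sum>k<m. of_bool (k = l) * g k) = (\<Sum>k<m. if k = l then g k else 0)"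
      by (intro sum.cong) auto
    then show ?thesis using that by simp
  qed
  moreover have "(\<Sum>k<m. of_bool (k + 1 = j) * g k) = (if j = 0 then 0 else g (j - 1))"
  proof (cases j)
    case (Suc i)
    then show ?thesis using delta[of i] assms by simp
  qed simp
  ultimately show ?thesis using assms by simp
qed

text \<open>Starting from the value 0 before the first row, column \<open>j\<close> of
  \<open>M\<close> has increments 1 / \<open>w k\<close> in the rows k <= j and 0 afterwards. The
  weighted increments are thus 1 up to \<open>j\<close> and then 0, and their differences form the
  Kronecker delta.\<close>

lemma type_D_matrix_inverse:
  assumes D: "type_D_matrix m a M" and nz: "a 1 \<noteq> 0"
  defines "w \<equiv> \<lambda>j. if j = 0 then 1 / a 1 else 1 / (a (j + 1) - a j)"
  shows "path_form_mat m w * M = 1\<^sub>m m"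
proof (rule eq_matI)
  have M: "M = mat m m (\<lambda>(i, j). if i \<le> j then a (i + 1) else a (j + 1))"
    and mono: "strict_mono_on {1..m} a"
    using D by (auto simp: type_D_matrix_def)
  fix i j assume "i < dim_row (1\<^sub>m m :: real mat)" "j < dim_col (1\<^sub>m m :: real mat)"
  then have ij: "i < m" "j < m" by auto
  have diff: "a (l + 1) - a l > 0" if "0 < l" "l < m" for l
    using strict_mono_onD[OF mono, of l "l + 1"] that by auto
  have "(path_form_mat m w * M) $$ (i, j)
      = (\<Sum>k<m. path_form_mat m w $$ (i, k) * (if k \<le> j then a (k + 1) else a (j + 1)))"
    using ij M by (auto simp: path_form_mat_def scalar_prod_def lessThan_atLeast0 intro!: sum.cong)
  also have "\<dots> = of_bool (i \<le> j) - of_bool (i + 1 \<le> j)"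
    using ij diff[of i] diff[of "i + 1"] nz
    by (subst path_form_mat_apply) (auto simp: w_def not_le dest: le_antisym)
  also have "\<dots> = 1\<^sub>m m $$ (i, j)" using ij by auto
  finally show "(path_form_mat m w * M) $$ (i, j) = 1\<^sub>m m $$ (i, j)" .
qed (use D in \<open>auto simp: type_D_matrix_def path_form_mat_def\<close>)

lemma tridiagonal_path_form_mat: "tridiagonal_mat (path_form_mat m w)"
  by (auto simp: tridiagonal_mat_def path_form_mat_def)

text \<open>\<open>w 0\<close> enters only the diagonal entry (0, 0), so it may be negative, as
  \<open>1 / a 1\<close> is in the application.\<close>

lemma Z_matrix_path_form_mat:
  assumes "\<And>j. 0 < j \<Longrightarrow> j < m \<Longrightarrow> w j \<ge> 0"
  shows "Z_matrix (path_form_mat m w)"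
  using assms by (auto simp: Z_matrix_def path_form_mat_def)

section \<open>Sign patterns of the columns of \<open>M\<close> and the F0 property of the
  inverse\<close>

theorem theorem4p21:
  fixes n :: nat and a :: "nat \<Rightarrow> real" and M :: "real mat"
  assumes "n \<ge> 2"
    and "type_D_matrix (n + 1) a M"
    and "a (n + 1) > 0"
    and "a n < 0"
  shows "invertible_mat M \<and>
    (\<forall>N. inverts_mat M N \<and> inverts_mat N M \<longrightarrow> tridiagonal_mat N \<and> F0_matrix N)"
proof -
  define m where "m = n + 1"
  have M: "M = mat m m (\<lambda>(i, j). if i \<le> j then a (i + 1) else a (j + 1))"
    and mono: "strict_mono_on {1..m} a"
    using assms(2) by (auto simp: type_D_matrix_def m_def)
  have Mc: "M \<in> carrier_mat m m" by (simp add: M)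
  have neg: "a (i + 1) < 0" if "i < n" for i
    using strict_mono_on_leD[OF mono, of "i + 1" n] that assms(4) by (auto simp: m_def)
  define w where "w j = (if j = 0 then 1 / a 1 else 1 / (a (j + 1) - a j))" for j
  define N where "N = path_form_mat m w"
  have Nc: "N \<in> carrier_mat m m" by (simp add: N_def path_form_mat_def)
  have NM: "N * M = 1\<^sub>m m"
    using type_D_matrix_inverse[of m a M] assms(1,2) neg[of 0]
    unfolding N_def m_def w_def by auto
  have MN: "M * N = 1\<^sub>m m" by (rule mat_mult_left_right_inverse[OF Nc Mc NM])
  have inv: "inverts_mat M N" "inverts_mat N M"
    using Mc Nc NM MN by (auto simp: inverts_mat_def)
  have unique: "N' = N" if "inverts_mat M N'" "inverts_mat N' M" for N'
  proof -
    have eq: "M * N' = 1\<^sub>m m" "N' * M = 1\<^sub>m (dim_row N')"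
      using that Mc by (auto simp: inverts_mat_def)
    \<comment> \<open>\<open>inverts_mat\<close> does not fix the shape of \<open>N'\<close>; it is
      read off from the two product equations.\<close>
    have "dim_col N' = m" using arg_cong[OF eq(1), of dim_col] by simp
    moreover have "dim_row N' = m" using arg_cong[OF eq(2), of dim_col] Mc by simp
    ultimately have N': "N' \<in> carrier_mat m m" by auto
    have "N = N * (M * N')" using eq(1) Nc by simp
    also have "\<dots> = N'" using NM Nc Mc N' by (simp flip: assoc_mult_mat[OF Nc Mc N'])
    finally show ?thesis by simp
  qed
  have Z: "Z_matrix N" unfolding N_def
  proof (rule Z_matrix_path_form_mat)
    fix j assume "0 < j" "j < m"
    then show "w j \<ge> 0" using strict_mono_onD[OF mono, of j "j + 1"] by (auto simp: w_def)
  qed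
  have col: "(\<Sum>k<m. N $$ (i, k) * M $$ (k, j)) = of_bool (i = j)" if "i < m" "j < m" for i j
  proof -
    have "(\<Sum>k<m. N $$ (i, k) * M $$ (k, j)) = (N * M) $$ (i, j)"
      using that Nc Mc by (auto simp: scalar_prod_def lessThan_atLeast0 intro!: sum.cong)
    then show ?thesis using that NM by simp
  qed
  \<comment> \<open>This includes the last row i = n, because min(i, p) <= p < n.\<close>
  have Mneg: "M $$ (i, p) < 0" if "i < m" "p < n" for i p
    using that neg[of i] neg[of p] by (auto simp: M m_def)
  have sub: "M_matrix (submatrix N I I)"
    if "I \<subseteq> {..<m}" "I \<noteq> {}" "p < n" "p \<notin> I" for I p
  proof (rule M_matrix_submatrix[OF Nc Z that(1,2), of "\<lambda>i. - M $$ (i, p)"])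
    fix i assume i: "i \<in> I"
    then have "i < m" "i \<noteq> p" using that by auto
    then have "(\<Sum>j<m. N $$ (i, j) * - M $$ (j, p)) = 0"
      using col[of i p] that(3) by (simp add: sum_negf m_def)
    then show "(\<Sum>j<m. N $$ (i, j) * - M $$ (j, p)) \<ge> 0" by simp
  qed (use Mneg that in auto)
  define C where "C = submatrix N {..<n} {..<n}"
  have C: "C \<in> carrier_mat n n" "\<And>i j. i < n \<Longrightarrow> j < n \<Longrightarrow> C $$ (i, j) = N $$ (i, j)"
    using principal_submatrix[OF Nc, of "{..<n}"]
    by (auto simp: C_def m_def pick_lessThan)
  have Csum: "(\<Sum>j<n. C $$ (i, j) * f j) = (\<Sum>j<m. N $$ (i, j) * f j) - N $$ (i, n) * f n"
    if "i < n" for i f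
    using that by (simp add: C m_def)
  have ZC: "Z_matrix C" unfolding C_def
    by (rule Z_matrix_submatrix[OF Nc Z]) (auto simp: m_def)
  \<comment> \<open>The coefficients cancel row \<open>n\<close>, where columns \<open>j\<close> and
    \<open>n\<close> of \<open>M\<close> have entries \<open>a (j + 1)\<close> and
    \<open>a (n + 1)\<close>. \<open>N\<close> sends column \<open>n\<close> to a unit vector
    vanishing on the rows below \<open>n\<close>, so only the unit vectors of the subtracted columns
    remain there, and they sum to -1.\<close>
  define x where "x i = (\<Sum>j<n. a (j + 1) / a (n + 1) * M $$ (i, n) - M $$ (i, j))" for i
  have "N0_matrix C"
  proof (rule N0_matrixI[OF C(1) ZC assms(1), where u = "\<lambda>p i. - M $$ (i, p)" and x = x])
    fix p i assume pi: "p < n" "i < n"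
    show "0 < - M $$ (i, p)" using Mneg pi by (simp add: m_def)
  next
    fix p i assume pi: "p < n" "i < n" and "i \<noteq> p"
    \<comment> \<open>Row \<open>i\<close> of \<open>N\<close> annihilates column \<open>p\<close>
      of \<open>M\<close>, so omitting the last index leaves exactly this product of two nonpositive
      numbers.\<close>
    moreover have "N $$ (i, n) * M $$ (n, p) \<ge> 0"
      using Z Nc pi Mneg[of n p] by (intro mult_nonpos_nonpos) (auto simp: Z_matrix_def m_def)
    ultimately show "(\<Sum>j<n. C $$ (i, j) * - M $$ (j, p)) \<ge> 0"
      using pi col[of i p] by (subst Csum) (auto simp: sum_negf m_def)
  next
    fix i assume i: "i < n"
    have "a (j + 1) / a (n + 1) * M $$ (i, n) - M $$ (i, j) > 0" if "j < n" for j
    proof -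
      have "a (j + 1) * a (i + 1) / a (n + 1) > 0"
        using neg[OF i] neg[OF that] assms(3) by (simp add: mult_neg_neg)
      then show ?thesis using Mneg[of i j] i that by (simp add: M m_def)
    qed
    then show "x i > 0" unfolding x_def using assms(1) by (intro sum_pos) (auto simp: lessThan_empty_iff)
    have "x n = 0" using assms(3) by (auto simp: x_def M m_def)
    then have "(\<Sum>k<n. C $$ (i, k) * x k) = (\<Sum>k<m. N $$ (i, k) * x k)"
      using Csum[OF i] by simp
    also have "\<dots> = (\<Sum>k<m. \<Sum>j<n. a (j + 1) / a (n + 1) * (N $$ (i, k) * M $$ (k, n))
                        - N $$ (i, k) * M $$ (k, j))"
      by (simp add: x_def sum_distrib_left right_diff_distrib mult_ac)
    also have "\<dots> = (\<Sum>j<n. a (j + 1) / a (n + 1) * (\<Sum>k<m. N $$ (i, k) * M $$ (k, n))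
                        - (\<Sum>k<m. N $$ (i, k) * M $$ (k, j)))"
      by (subst sum.swap) (simp only: sum_subtractf sum_distrib_left)
    also have "\<dots> = (\<Sum>j<n. - of_bool (i = j))"
      using i col by (intro sum.cong) (auto simp: m_def)
    also have "\<dots> = - 1" using i by (simp add: sum_negf of_bool_def)
    finally show "(\<Sum>k<n. C $$ (i, k) * x k) < 0" by simp
  qed
  then have "\<exists>C \<in> principal_submatrices (m - 1) N. N0_matrix C"
    unfolding principal_submatrices_def C_def using Nc
    by (intro bexI[of _ "submatrix N {..<n} {..<n}"]) (auto simp: m_def intro!: exI[of _ "{..<n}"])
  moreover have "M_matrix D" if k: "k \<in> {1..m - 2}" and D: "D \<in> principal_submatrices k N" for k D
  proof -
    obtain I where I: "D = submatrix N I I" "I \<subseteq> {..<m}" "card I = k"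
      using D Nc by (auto simp: principal_submatrices_def)
    \<comment> \<open>\<open>I\<close> has at most m - 2 = n - 1 elements, so it omits an index
      below \<open>n\<close>, as \<open>sub\<close> needs.\<close>
    have "\<not> {..<n} \<subseteq> I"
      using card_mono[of I "{..<n}"] I k finite_subset[OF I(2)] assms(1) by (auto simp: m_def)
    then obtain p where "p < n" "p \<notin> I" by auto
    moreover have "I \<noteq> {}" using I k by auto
    ultimately show ?thesis using sub I by simp
  qed
  ultimately have "F0_matrix N"
    unfolding F0_matrix_def using Nc Z assms(1) by (auto simp: m_def)
  moreover have "invertible_mat M" using inv Mc by (auto simp: invertible_mat_def)
  ultimately show ?thesis using unique tridiagonal_path_form_mat[of m w] N_def by metis
qed

end
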